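(* Let $1\le r\le n$ be integers, let $\mathcal{P},\mathcal{N}$ be disjoint subsets of $\{1,\dots,r\}$ with $|\mathcal{P}|+|\mathcal{N}|=1$, and let $S$ and $\mathbb{S}^{n,r}_S$ be the associated sign matrix and sign-constrained Stiefel manifold. For any matrix $X\in\mathbb{R}^{n\times r}$, $$\operatorname{dist}(X,\mathbb{S}^{n,r}_S)\;\le\;7\sqrt r\left(\|(S\circ X)_-\|_F+\|X^{T}X-I_r\|_F\right).$$ Moreover, if $\|X^{T}X-I_r\|_F<1/3$, then $$\operatorname{dist}(X,\mathbb{S}^{n,r}_S)\;\le\;7\left(\|(S\circ X)_-\|_F+\|X^{T}X-I_r\|_F\right).$$
   Context: The sign matrix $S\in\mathbb{R}^{n\times r}$ is defined by $S_{i,j}=1$ if $j\in\mathcal{P}$, $S_{i,j}=-1$ if $j\in\mathcal{N}$, and $S_{i,j}=0$ otherwise ($1\le i\le n$). $\circ$ is the Hadamard (entry-wise) product. The sign-constrained Stiefel manifold is $\mathbb{S}^{n,r}_S=\{X\in\mathbb{R}^{n\times r}: S\circ X\ge 0,\ X^{T}X=I_r\}$, where $\ge$ is entry-wise and $I_r$ is the $r\times r$ identity. For a matrix $Y$, $Y_-=\max\{-Y,0\}$ entry-wise. $\|\cdot\|_F$ is the Frobenius norm and $\operatorname{dist}(X,\mathcal{T})$ is the distance from $X$ to the set $\mathcal{T}\subset\mathbb{R}^{n\times r}$ in the Frobenius norm. *)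

theory Defs
  imports "HOL-Analysis.Analysis"
begin

text \<open>
  An \<open>n\<close>-by-\<open>r\<close> real matrix is an element of \<open>real ^ 'r ^ 'n\<close> with \<open>n = CARD('n)\<close> and
  \<open>r = CARD('r)\<close>; the entry in row \<open>i\<close> and column \<open>j\<close> is \<open>X $ i $ j\<close>.
  The library's \<open>norm\<close> on this type is the Frobenius norm, as the next lemma records, so that
  \<open>dist\<close> and \<open>infdist\<close> are the corresponding distances between matrices and to a set of matrices.
\<close>

lemma norm_matrix_eq_Frobenius:
  fixes A :: "real ^ 'r ^ 'n"
  shows "norm A = sqrt (\<Sum>i\<in>UNIV. \<Sum>j\<in>UNIV. (A $ i $ j)\<^sup>2)"
  by (simp add: norm_vec_def L2_set_def sum_nonneg)

definition hadamard :: "real ^ 'r ^ 'n \<Rightarrow> real ^ 'r ^ 'n \<Rightarrow> real ^ 'r ^ 'n" (infixl "\<circ>\<^sub>H" 70) where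
  "A \<circ>\<^sub>H B = (\<chi> i j. A $ i $ j * B $ i $ j)"

definition neg_part :: "real ^ 'r ^ 'n \<Rightarrow> real ^ 'r ^ 'n" where
  "neg_part Y = (\<chi> i j. max (- (Y $ i $ j)) 0)"

definition sign_matrix :: "'r set \<Rightarrow> 'r set \<Rightarrow> real ^ 'r ^ 'n" where
  "sign_matrix P N = (\<chi> i j. if j \<in> P then 1 else if j \<in> N then - 1 else 0)"

definition sign_stiefel :: "real ^ 'r ^ 'n \<Rightarrow> (real ^ 'r ^ 'n) set" where
  "sign_stiefel S = {X. (\<forall>i j. 0 \<le> (S \<circ>\<^sub>H X) $ i $ j) \<and> transpose X ** X = mat 1}"

end

theory Submission
  imports Defs
begin

text \<open>
  After multiplying \<open>X\<close> by \<open>-1\<close> if necessary, the only sign condition is that one column, the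
  \<open>j\<close>-th, be nonnegative. Write \<open>\<delta> = norm (transpose X ** X - mat 1)\<close> and let \<open>\<nu>\<close> be the norm of the
  negative part of that column. A feasible point \<open>Y\<close> with \<open>dist X Y \<le> 2 * \<nu> + 3 * \<delta>\<close> is reached in
  two moves, and this bound implies both claimed ones, because \<open>r \<ge> 1\<close>.

  The first move goes to a matrix \<open>U\<close> with orthonormal columns and costs at most \<open>\<delta>\<close>
  (\<open>dist_stiefel_le\<close>). Take \<open>U\<close> to maximise \<open>U \<bullet> X\<close>; then \<open>X = U ** H\<close> is a polar decomposition,
  with \<open>H\<close> symmetric and positive semidefinite. Therefore \<open>norm (X - U) = norm (H - mat 1)\<close> and
  \<open>transpose X ** X - mat 1 = (H + mat 1) ** (H - mat 1)\<close>, and multiplying by \<open>H + mat 1\<close> does not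
  decrease the norm. Both properties of \<open>H\<close> follow from maximality, by comparing \<open>U\<close> with its images
  under one reflection and under a product of two (\<open>maximiser_symmetric_psd\<close>).

  The second move makes column \<open>j\<close> nonnegative (\<open>nonneg_column_stiefel\<close>). The negative part of
  the unit vector \<open>u = column j U\<close> has norm at most \<open>\<nu> + \<delta>\<close>, since the first move displaced column
  \<open>j\<close> by at most \<open>\<delta>\<close>. Let \<open>y\<close> be the normalised positive part of \<open>u\<close> and apply to all columns the
  rotation in the plane of \<open>u\<close> and \<open>y\<close> that carries \<open>u\<close> to \<open>y\<close>. Column \<open>j\<close> moves by
  \<open>norm (u - y)\<close>, and by Bessel's inequality all other columns together move by no more than that
  (\<open>rotate_column\<close>). So the price does not grow with the number of columns: it is at most twice the
  norm of the negative part of \<open>u\<close>.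
\<close>

section \<open>Matrices with orthonormal columns\<close>

lemma orthonormal_columns_iff:
  fixes U :: "real ^ 'r ^ 'n"
  shows "transpose U ** U = mat 1 \<longleftrightarrow>
    (\<forall>i j. column i U \<bullet> column j U = (if i = j then 1 else 0))"
  by (simp add: matrix_mult_transpose_dot_column vec_eq_iff mat_def)

lemma inner_matrix_eq_sum_columns:
  fixes A B :: "real ^ 'r ^ 'n"
  shows "A \<bullet> B = (\<Sum>j\<in>UNIV. column j A \<bullet> column j B)"
  unfolding inner_vec_def column_def inner_real_def
  by (subst sum.swap) simp

lemma norm_matrix_sq_eq_sum_columns:
  fixes A :: "real ^ 'r ^ 'n"
  shows "(norm A)\<^sup>2 = (\<Sum>j\<in>UNIV. (norm (column j A))\<^sup>2)"
  by (simp add: power2_norm_eq_inner inner_matrix_eq_sum_columns)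

lemma column_diff: "column j (A - B) = column j A - column j (B :: real ^ 'r ^ 'n)"
  by (simp add: column_def vec_eq_iff)

lemma column_matrix_mult: "column j (A ** B) = A *v column j (B :: real ^ 'r ^ 'm)"
  by (simp add: column_def vec_eq_iff matrix_matrix_mult_def matrix_vector_mult_def)

lemma matrix_diff_ldistrib: "A ** (B - C) = A ** B - A ** (C :: real ^ 'r ^ 'm)"
  by (simp add: matrix_matrix_mult_def vec_eq_iff sum_subtractf right_diff_distrib)

lemma norm_column_le_norm_matrix:
  fixes A :: "real ^ 'r ^ 'n"
  shows "norm (column j A) \<le> norm A"
proof -
  have "(norm (column j A))\<^sup>2 \<le> (norm A)\<^sup>2"
    unfolding norm_matrix_sq_eq_sum_columns
    by (rule member_le_sum) auto
  then show ?thesis by (rule power2_le_imp_le) simp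
qed

definition map_columns :: "(real ^ 'n \<Rightarrow> real ^ 'n) \<Rightarrow> real ^ 'r ^ 'n \<Rightarrow> real ^ 'r ^ 'n" where
  "map_columns f A = (\<chi> i j. f (column j A) $ i)"

lemma column_map_columns [simp]: "column j (map_columns f A) = f (column j A)"
  by (simp add: map_columns_def column_def vec_eq_iff)

text \<open>
  This is the orthogonal reflection in the hyperplane perpendicular to \<open>v\<close>. For \<open>v = 0\<close> it is the
  identity, because division by zero yields zero, so it is an isometry for every \<open>v\<close>.
\<close>
definition reflect :: "'a::real_inner \<Rightarrow> 'a \<Rightarrow> 'a" where
  "reflect v x = x - (2 * (v \<bullet> x) / (v \<bullet> v)) *\<^sub>R v"

lemma inner_reflect: "reflect v x \<bullet> y = x \<bullet> y - 2 * (v \<bullet> x) / (v \<bullet> v) * (v \<bullet> y)"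
  by (simp add: reflect_def inner_diff)

lemma inner_reflect_reflect: "reflect v x \<bullet> reflect v y = x \<bullet> y"
  by (cases "v = 0") (simp_all add: reflect_def inner_diff inner_commute field_simps)

lemma orthonormal_map_columns:
  assumes "transpose U ** U = (mat 1 :: real ^ 'r ^ 'r)"
    and "\<And>x y. f x \<bullet> f y = x \<bullet> y"
  shows "transpose (map_columns f U) ** map_columns f U = mat 1"
  using assms by (simp add: orthonormal_columns_iff)

lemma inner_mult_orthonormal:
  fixes U :: "real ^ 'r ^ 'n"
  assumes "transpose U ** U = mat 1"
  shows "(U *v x) \<bullet> (U *v y) = x \<bullet> y"
proof -
  have "(U *v x) \<bullet> (U *v y) = x \<bullet> (transpose U *v (U *v y))"
    by (metis dot_lmul_matrix inner_commute transpose_matrix_vector)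
  then show ?thesis by (simp only: matrix_vector_mul_assoc assms matrix_vector_mul_lid)
qed

lemma norm_orthonormal_mult:
  fixes U :: "real ^ 'r ^ 'n" and B :: "real ^ 'k ^ 'r"
  assumes "transpose U ** U = mat 1"
  shows "norm (U ** B) = norm B"
proof -
  have "(norm (U ** B))\<^sup>2 = (norm B)\<^sup>2"
    by (simp add: norm_matrix_sq_eq_sum_columns column_matrix_mult power2_norm_eq_inner
        inner_mult_orthonormal[OF assms])
  then show ?thesis by simp
qed

text \<open>
  The vector \<open>U *v (y v* U)\<close> is the orthogonal projection of \<open>y\<close> to the span of the columns, and its
  squared norm is the left-hand side.
\<close>
lemma Bessel_columns:
  fixes U :: "real ^ 'r ^ 'n"
  assumes U: "transpose U ** U = mat 1"
  shows "(\<Sum>j\<in>UNIV. (column j U \<bullet> y)\<^sup>2) \<le> y \<bullet> y"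
proof -
  define w where "w = y v* U"
  have "0 \<le> (y - U *v w) \<bullet> (y - U *v w)" by simp
  also have "\<dots> = y \<bullet> y - 2 * (y \<bullet> (U *v w)) + w \<bullet> w"
    by (simp add: inner_diff inner_mult_orthonormal[OF U] inner_commute)
  also have "y \<bullet> (U *v w) = w \<bullet> w"
    by (simp add: w_def dot_lmul_matrix)
  also have "w \<bullet> w = (\<Sum>j\<in>UNIV. (column j U \<bullet> y)\<^sup>2)"
    by (simp add: w_def inner_vec_def vector_matrix_mult_def column_def power2_eq_square mult.commute)
  finally show ?thesis by simp
qed

lemma compact_stiefel:
  "compact {U :: real ^ 'r ^ 'n. transpose U ** U = mat 1}" (is "compact ?S")
proof -
  have "closed ?S"
    unfolding orthonormal_columns_iff column_def inner_vec_def
    by (intro closed_Collect_all closed_Collect_eq continuous_intros)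
  moreover have "bounded ?S"
  proof (rule boundedI)
    fix U :: "real ^ 'r ^ 'n" assume "U \<in> ?S"
    then have "(norm U)\<^sup>2 = real CARD('r)"
      by (simp add: norm_matrix_sq_eq_sum_columns power2_norm_eq_inner orthonormal_columns_iff)
    then show "norm U \<le> sqrt (real CARD('r))"
      by (metis norm_ge_zero order_refl real_sqrt_unique)
  qed
  ultimately show ?thesis by (simp add: compact_eq_bounded_closed)
qed

lemma stiefel_nonempty:
  assumes "CARD('r) \<le> CARD('n)"
  shows "\<exists>U :: real ^ 'r ^ 'n. transpose U ** U = mat 1"
proof -
  obtain f :: "'r \<Rightarrow> 'n" where f: "inj f"
    using assms card_le_inj[of "UNIV :: 'r set" "UNIV :: 'n set"] by auto
  define U :: "real ^ 'r ^ 'n" where "U = (\<chi> i j. axis (f j) 1 $ i)"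
  have "column j U = axis (f j) 1" for j
    by (simp add: U_def column_def vec_eq_iff)
  then have "transpose U ** U = mat 1"
    using f by (auto simp: orthonormal_columns_iff inner_axis_axis inj_eq)
  then show ?thesis by blast
qed

section \<open>Polar decomposition by maximisation\<close>

text \<open>
  The bilinear form of \<open>X ** transpose U\<close>, written through columns, is what appears when reflections
  are applied to the columns of \<open>U\<close> in the objective \<open>U \<bullet> X\<close>.
\<close>
lemma inner_mult_transpose:
  fixes U X :: "real ^ 'r ^ 'n"
  shows "v \<bullet> ((X ** transpose U) *v w) = (\<Sum>j\<in>UNIV. (v \<bullet> column j X) * (w \<bullet> column j U))"
proof -
  have "v \<bullet> ((X ** transpose U) *v w) = (v v* X) \<bullet> (w v* U)"
    by (simp add: matrix_vector_mul_assoc[symmetric] dot_lmul_matrix)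
  then show ?thesis
    by (simp add: inner_vec_def vector_matrix_mult_def column_def mult.commute)
qed

lemma linear_coefficient_zero:
  fixes a b :: real
  assumes "\<And>t. 0 \<le> a * t + b * t\<^sup>2"
  shows "a = 0"
proof (rule ccontr)
  assume a: "a \<noteq> 0"
  \<comment> \<open>Small enough for the linear term to win, and of the sign that makes it negative.\<close>
  define t where "t = - a / (\<bar>b\<bar> + 1)"
  have "a * t + b * t\<^sup>2 \<le> a * t + \<bar>b\<bar> * t\<^sup>2" by (simp add: mult_right_mono)
  also have "\<dots> = - t\<^sup>2"
  proof -
    have "a = - t * (\<bar>b\<bar> + 1)" by (simp add: t_def field_simps)
    then have "a * t + \<bar>b\<bar> * t\<^sup>2 = - t * (\<bar>b\<bar> + 1) * t + \<bar>b\<bar> * t\<^sup>2" by simp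
    then show ?thesis by (simp add: algebra_simps power2_eq_square)
  qed
  also have "\<dots> < 0" using a by (simp add: t_def)
  finally show False using assms[of t] by simp
qed

text \<open>
  Put \<open>M = X ** transpose U\<close>. Reflecting the columns of \<open>U\<close> along \<open>v\<close> changes \<open>U \<bullet> X\<close> by a negative
  multiple of \<open>v \<bullet> (M *v v)\<close>, so this form is nonnegative. Symmetry needs perturbations close to the
  identity, which a single reflection never is; but the reflections along \<open>v\<close> and along
  \<open>v + t *\<^sub>R z\<close> with \<open>t\<close> small compose to a small rotation. Its effect to first order in
  \<open>t\<close> is a multiple of \<open>z \<bullet> (M *v v) - v \<bullet> (M *v z)\<close>, which must vanish as \<open>t\<close> may have either sign.
\<close>
lemma maximiser_symmetric_psd:
  fixes U X :: "real ^ 'r ^ 'n"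
  assumes U: "transpose U ** U = mat 1"
    and max: "\<And>V :: real ^ 'r ^ 'n. transpose V ** V = mat 1 \<Longrightarrow> V \<bullet> X \<le> U \<bullet> X"
  shows "0 \<le> v \<bullet> ((X ** transpose U) *v v)"
    and "transpose (X ** transpose U) = X ** transpose U"
proof -
  define M where "M = X ** transpose U"
  have M: "v \<bullet> (M *v w) = (\<Sum>j\<in>UNIV. (v \<bullet> column j X) * (w \<bullet> column j U))" for v w
    unfolding M_def by (rule inner_mult_transpose)
  have psd: "0 \<le> v \<bullet> (M *v v)" for v
  proof (cases "v = 0")
    case False
    have "map_columns (reflect v) U \<bullet> X \<le> U \<bullet> X"
      by (intro max orthonormal_map_columns U inner_reflect_reflect)
    moreover have "map_columns (reflect v) U \<bullet> X = U \<bullet> X - 2 / (v \<bullet> v) * (v \<bullet> (M *v v))"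
      unfolding M inner_matrix_eq_sum_columns sum_distrib_left sum_subtractf[symmetric]
      by (intro sum.cong) (simp_all add: reflect_def inner_diff)
    ultimately have "0 \<le> 2 / (v \<bullet> v) * (v \<bullet> (M *v v))" by simp
    moreover have "0 < 2 / (v \<bullet> v)" using False by simp
    ultimately show ?thesis by (metis mult_le_cancel_left_pos mult_zero_right)
  qed simp
  have two: "2 * (v \<bullet> w) * (v \<bullet> (M *v w)) \<le> (w \<bullet> w) * (v \<bullet> (M *v v)) + (v \<bullet> v) * (w \<bullet> (M *v w))"
    for v w
  proof (cases "v = 0 \<or> w = 0")
    case False
    then have pos: "0 < v \<bullet> v" "0 < w \<bullet> w" by auto
    have "map_columns (reflect v \<circ> reflect w) U \<bullet> X \<le> U \<bullet> X"
      by (intro max orthonormal_map_columns U) (simp add: inner_reflect_reflect)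
    moreover have "map_columns (reflect v \<circ> reflect w) U \<bullet> X = U \<bullet> X - 2 / (v \<bullet> v) * (v \<bullet> (M *v v))
        - 2 / (w \<bullet> w) * (w \<bullet> (M *v w)) + 4 * (v \<bullet> w) / ((v \<bullet> v) * (w \<bullet> w)) * (v \<bullet> (M *v w))"
      unfolding M inner_matrix_eq_sum_columns sum_distrib_left sum_subtractf[symmetric]
        sum.distrib[symmetric]
    proof (intro sum.cong refl)
      fix j
      have "w \<bullet> v = v \<bullet> w" "column j U \<bullet> v = v \<bullet> column j U"
        by (simp_all add: inner_commute)
      then show "column j (map_columns (reflect v \<circ> reflect w) U) \<bullet> column j X =
          column j U \<bullet> column j X - 2 / (v \<bullet> v) * (v \<bullet> column j X * (v \<bullet> column j U))
          - 2 / (w \<bullet> w) * (w \<bullet> column j X * (w \<bullet> column j U))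
          + 4 * (v \<bullet> w) / ((v \<bullet> v) * (w \<bullet> w)) * (v \<bullet> column j X * (w \<bullet> column j U))"
        using pos
        by (simp add: inner_reflect inner_commute[of v "reflect w (column j U)"])
          (simp add: field_simps)
    qed
    ultimately have "4 * (v \<bullet> w) / ((v \<bullet> v) * (w \<bullet> w)) * (v \<bullet> (M *v w)) \<le>
        2 / (v \<bullet> v) * (v \<bullet> (M *v v)) + 2 / (w \<bullet> w) * (w \<bullet> (M *v w))" by simp
    then have "(v \<bullet> v) * (w \<bullet> w) * (4 * (v \<bullet> w) / ((v \<bullet> v) * (w \<bullet> w)) * (v \<bullet> (M *v w))) \<le>
        (v \<bullet> v) * (w \<bullet> w) * (2 / (v \<bullet> v) * (v \<bullet> (M *v v)) + 2 / (w \<bullet> w) * (w \<bullet> (M *v w)))"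
      using pos by (intro mult_left_mono) auto
    moreover have "(v \<bullet> v) * (w \<bullet> w) * (4 * (v \<bullet> w) / ((v \<bullet> v) * (w \<bullet> w)) * (v \<bullet> (M *v w)))
        = 4 * (v \<bullet> w) * (v \<bullet> (M *v w))" using False by simp
    moreover have "(v \<bullet> v) * (w \<bullet> w) * (2 / (v \<bullet> v) * (v \<bullet> (M *v v)) + 2 / (w \<bullet> w) * (w \<bullet> (M *v w)))
        = 2 * ((w \<bullet> w) * (v \<bullet> (M *v v))) + 2 * ((v \<bullet> v) * (w \<bullet> (M *v w)))"
      using False by (simp add: algebra_simps)
    ultimately show ?thesis by linarith
  qed auto
  have sym: "v \<bullet> (M *v z) = z \<bullet> (M *v v)" for v z
  proof (cases "v = 0")
    case False
    \<comment> \<open>The inequality for two reflections along \<open>v\<close> and \<open>v + t z\<close> says \<open>0 \<le> a t + b t^2\<close>;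
      its constant terms cancel.\<close>
    define q where "q = v \<bullet> (M *v v)"
    define a where "a = (v \<bullet> v) * (z \<bullet> (M *v v) - v \<bullet> (M *v z))"
    define b where "b = (z \<bullet> z) * q + (v \<bullet> v) * (z \<bullet> (M *v z)) - 2 * (v \<bullet> z) * (v \<bullet> (M *v z))"
    have "0 \<le> a * t + b * t\<^sup>2" for t
      using two[of v "v + t *\<^sub>R z"]
      by (simp add: a_def b_def q_def algebra_simps inner_simps inner_commute[of z v]
          power2_eq_square matrix_vector_right_distrib matrix_vector_mult_scaleR)
    then have "a = 0" by (rule linear_coefficient_zero)
    with False show ?thesis by (simp add: a_def)
  qed simp
  have "transpose M *v v = M *v v" for v
  proof (rule vector_eq_rdot[THEN iffD1, rule_format])
    fix z
    have "(transpose M *v v) \<bullet> z = v \<bullet> (M *v z)" by (simp add: dot_lmul_matrix)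
    then show "(transpose M *v v) \<bullet> z = (M *v v) \<bullet> z"
      using sym[of v z] by (simp only: inner_commute[of _ z])
  qed
  then have "transpose M = M" using matrix_eq by blast
  then show "transpose (X ** transpose U) = X ** transpose U" unfolding M_def .
  show "0 \<le> v \<bullet> ((X ** transpose U) *v v)" using psd unfolding M_def .
qed

text \<open>
  With \<open>B = H - mat 1\<close> one has \<open>H ** H - mat 1 = H ** B + B\<close>, and each column \<open>b\<close> of \<open>B\<close> satisfies
  \<open>norm (H *v b + b) \<ge> norm b\<close> because the cross term \<open>2 * (b \<bullet> (H *v b))\<close> is nonnegative. When
  \<open>H\<close> is the symmetric polar factor of a matrix with singular values \<open>\<sigma>\<close>, this reflects \<open>\<bar>\<sigma> - 1\<bar> \<le> \<bar>\<sigma>\<^sup>2 - 1\<bar>\<close> for \<open>\<sigma> \<ge> 0\<close>.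
\<close>
lemma norm_psd_minus_one_le:
  fixes H :: "real ^ 'r ^ 'r"
  assumes psd: "\<And>b. 0 \<le> b \<bullet> (H *v b)"
  shows "norm (H - mat 1) \<le> norm (H ** H - mat 1)"
proof -
  define B where "B = H - mat 1"
  have "H ** H - mat 1 = H ** B + B"
    by (simp add: B_def matrix_diff_ldistrib)
  then have col: "column k (H ** H - mat 1) = H *v column k B + column k B" for k
    by (simp add: column_matrix_mult[symmetric]) (simp add: column_def vec_eq_iff)
  have "(norm b)\<^sup>2 \<le> (norm (H *v b + b))\<^sup>2" for b
    using psd[of b] by (simp add: power2_norm_eq_inner inner_add inner_commute)
  then have "(norm B)\<^sup>2 \<le> (norm (H ** H - mat 1))\<^sup>2"
    unfolding norm_matrix_sq_eq_sum_columns[of B] norm_matrix_sq_eq_sum_columns[of "H ** H - mat 1"] col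
    by (intro sum_mono)
  then show ?thesis unfolding B_def by (rule power2_le_imp_le) simp
qed

text \<open>
  The matrix \<open>U\<close> is the orthonormal polar factor of \<open>X\<close>, found as a maximiser of \<open>U \<bullet> X\<close>. Symmetry
  of \<open>X ** transpose U\<close> gives \<open>X = U ** H\<close> with \<open>H = transpose X ** U\<close>; in particular the
  columns of \<open>X\<close> lie in the span of those of \<open>U\<close>, and the residual \<open>X - U\<close> is seen entirely by \<open>H\<close>.
\<close>
lemma dist_stiefel_le:
  fixes X :: "real ^ 'r ^ 'n"
  assumes "CARD('r) \<le> CARD('n)"
  obtains U :: "real ^ 'r ^ 'n"
  where "transpose U ** U = mat 1" and "norm (X - U) \<le> norm (transpose X ** X - mat 1)"
proof -
  obtain U :: "real ^ 'r ^ 'n" where U: "transpose U ** U = mat 1"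
    and max: "\<And>V :: real ^ 'r ^ 'n. transpose V ** V = mat 1 \<Longrightarrow> V \<bullet> X \<le> U \<bullet> X"
  proof -
    have "continuous_on {U :: real ^ 'r ^ 'n. transpose U ** U = mat 1} (\<lambda>U. U \<bullet> X)"
      by (intro continuous_intros)
    from continuous_attains_sup[OF compact_stiefel _ this] stiefel_nonempty[OF assms] that
    show ?thesis by blast
  qed
  note M = maximiser_symmetric_psd[OF U max]
  define H where "H = transpose X ** U"
  have "X = X ** (transpose U ** U)" by (simp add: U)
  also have "\<dots> = transpose (X ** transpose U) ** U" by (simp add: M(2) matrix_mul_assoc)
  also have "\<dots> = U ** H" by (simp add: H_def matrix_transpose_mul matrix_mul_assoc)
  finally have X: "X = U ** H" .
  have "transpose H = transpose U ** X" by (simp add: H_def matrix_transpose_mul)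
  also have "\<dots> = transpose U ** (U ** H)" using X by simp
  also have "\<dots> = H" by (simp add: matrix_mul_assoc U)
  finally have H: "transpose H = H" .
  have "transpose X ** X = transpose (U ** H) ** (U ** H)" using X by simp
  also have "\<dots> = transpose H ** (transpose U ** U) ** H"
    by (simp only: matrix_transpose_mul matrix_mul_assoc)
  also have "\<dots> = H ** H" by (simp add: U H)
  finally have XX: "transpose X ** X = H ** H" .
  have psd: "0 \<le> b \<bullet> (H *v b)" for b
  proof -
    have "(U *v b) \<bullet> ((X ** transpose U) *v (U *v b)) = (U *v b) \<bullet> (X *v b)"
      by (simp only: matrix_vector_mul_assoc matrix_mul_assoc[symmetric] U matrix_mul_rid)
    also have "\<dots> = (U *v b) \<bullet> (U *v (H *v b))"
      using X by (simp add: matrix_vector_mul_assoc)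
    also have "\<dots> = b \<bullet> (H *v b)" by (rule inner_mult_orthonormal[OF U])
    finally show ?thesis using M(1)[of "U *v b"] by simp
  qed
  have "X - U = U ** (H - mat 1)" using X by (simp add: matrix_diff_ldistrib)
  then have "norm (X - U) = norm (H - mat 1)" by (simp add: norm_orthonormal_mult[OF U])
  also have "\<dots> \<le> norm (transpose X ** X - mat 1)"
    unfolding XX by (rule norm_psd_minus_one_le[OF psd])
  finally show thesis using U that by blast
qed

section \<open>Making one column nonnegative\<close>

text \<open>
  The reflection along \<open>u + y\<close> sends \<open>u\<close> to \<open>- y\<close> and the one along \<open>y\<close> restores the sign, so the
  product is the rotation of the plane of \<open>u\<close> and \<open>y\<close> that carries \<open>u\<close> to \<open>y\<close>. The condition
  \<open>- 1 < u \<bullet> y\<close> excludes antipodal vectors, for which \<open>u + y = 0\<close>.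
\<close>
lemma double_reflection:
  fixes u y c :: "'a::real_inner"
  assumes u: "u \<bullet> u = 1" and y: "y \<bullet> y = 1" and k: "- 1 < u \<bullet> y"
  shows "reflect y (reflect (u + y) u) = y"
    and "c \<bullet> u = 0 \<Longrightarrow>
      reflect y (reflect (u + y) c) = c - (c \<bullet> y / (1 + u \<bullet> y)) *\<^sub>R (u + y)"
proof -
  have uy: "(u + y) \<bullet> (u + y) = 2 * (1 + u \<bullet> y)"
    using u y by (simp add: inner_add inner_commute)
  have "reflect (u + y) u = - y"
    using k unfolding reflect_def uy by (simp add: inner_add u inner_commute[of y u])
  then show "reflect y (reflect (u + y) u) = y"
    by (simp add: reflect_def y scaleR_2)
  assume c: "c \<bullet> u = 0"
  have "(u + y) \<bullet> c = c \<bullet> y" using c by (simp add: inner_add inner_commute)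
  then have "2 * ((u + y) \<bullet> c) / ((u + y) \<bullet> (u + y)) = c \<bullet> y / (1 + u \<bullet> y)"
    using k unfolding uy by (simp add: divide_simps)
  then have r: "reflect (u + y) c = c - (c \<bullet> y / (1 + u \<bullet> y)) *\<^sub>R (u + y)"
    by (simp only: reflect_def)
  have "reflect (u + y) c \<bullet> y = c \<bullet> y - c \<bullet> y / (1 + u \<bullet> y) * (1 + u \<bullet> y)"
    unfolding r by (simp add: inner_diff_left inner_add_left y add.commute)
  then have "reflect (u + y) c \<bullet> y = 0" using k by simp
  moreover have "reflect y z = z" if "z \<bullet> y = 0" for z
    using that by (simp add: reflect_def inner_commute)
  ultimately have "reflect y (reflect (u + y) c) = reflect (u + y) c"
    by blast
  then show "reflect y (reflect (u + y) c) = c - (c \<bullet> y / (1 + u \<bullet> y)) *\<^sub>R (u + y)"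
    by (simp only: r)
qed

text \<open>
  Put \<open>u = column j U\<close>. The rotation moves another column \<open>c\<close> by \<open>(c \<bullet> y / (1 + u \<bullet> y)) *\<^sub>R (u + y)\<close>,
  of squared norm \<open>2 * (c \<bullet> y)\<^sup>2 / (1 + u \<bullet> y)\<close>. By Bessel's inequality these sum to at most
  \<open>2 * (1 - (u \<bullet> y)\<^sup>2) / (1 + u \<bullet> y) = 2 * (1 - u \<bullet> y)\<close>, which equals the squared displacement of \<open>u\<close>
  itself. Hence the bound does not depend on the number of columns.
\<close>
lemma rotate_column:
  fixes U :: "real ^ 'r ^ 'n"
  assumes U: "transpose U ** U = mat 1" and y: "y \<bullet> y = 1" and k: "- 1 < column j U \<bullet> y"
  obtains Y :: "real ^ 'r ^ 'n" where "transpose Y ** Y = mat 1" and "column j Y = y"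
    and "(norm (Y - U))\<^sup>2 \<le> 4 * (1 - column j U \<bullet> y)"
proof -
  define u where "u = column j U"
  define R where "R = reflect y \<circ> reflect (u + y)"
  define Y where "Y = map_columns R U"
  have on: "column i U \<bullet> column i' U = (if i = i' then 1 else 0)" for i i'
    using U by (simp add: orthonormal_columns_iff)
  have u: "u \<bullet> u = 1" by (simp add: u_def on)
  have k1: "0 < 1 + u \<bullet> y" using k by (simp add: u_def)
  have uy: "(u + y) \<bullet> (u + y) = 2 * (1 + u \<bullet> y)"
    using u y by (simp add: inner_add inner_commute)
  have dr: "R u = y" "c \<bullet> u = 0 \<Longrightarrow> R c = c - (c \<bullet> y / (1 + u \<bullet> y)) *\<^sub>R (u + y)" for c
    using double_reflection[OF u y] k1 by (simp_all add: R_def)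
  have YY: "transpose Y ** Y = mat 1"
    unfolding Y_def by (intro orthonormal_map_columns U) (simp add: R_def inner_reflect_reflect)
  have colj: "column j Y = y" using dr(1) by (simp add: Y_def u_def)
  have 1: "(norm (column j (Y - U)))\<^sup>2 = 2 * (1 - u \<bullet> y)"
    unfolding column_diff colj u_def[symmetric]
    using u y by (simp add: power2_norm_eq_inner inner_diff inner_commute)
  have 2: "(norm (column i (Y - U)))\<^sup>2 = 2 * (column i U \<bullet> y)\<^sup>2 / (1 + u \<bullet> y)" if "i \<noteq> j" for i
  proof -
    have "column i U \<bullet> u = 0" using that by (simp add: u_def on)
    then have "column i (Y - U) = - (column i U \<bullet> y / (1 + u \<bullet> y)) *\<^sub>R (u + y)"
      unfolding column_diff by (simp add: Y_def dr(2))
    then have "(norm (column i (Y - U)))\<^sup>2 = (column i U \<bullet> y / (1 + u \<bullet> y))\<^sup>2 * ((u + y) \<bullet> (u + y))"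
      by (simp add: power2_norm_eq_inner[symmetric] power_mult_distrib power_divide)
    also have "\<dots> = 2 * (column i U \<bullet> y)\<^sup>2 / (1 + u \<bullet> y)"
    proof -
      have "(a / s)\<^sup>2 * (2 * s) = 2 * a\<^sup>2 / s" if "0 < s" for a s :: real
        using that by (simp add: power2_eq_square)
      then show ?thesis using k1 by (simp only: uy)
    qed
    finally show ?thesis .
  qed
  have "(\<Sum>i\<in>UNIV - {j}. (column i U \<bullet> y)\<^sup>2) \<le> 1 - (u \<bullet> y)\<^sup>2"
    using Bessel_columns[OF U, of y] y by (simp add: u_def sum.remove[of UNIV j])
  then have "(\<Sum>i\<in>UNIV - {j}. (norm (column i (Y - U)))\<^sup>2) \<le> 2 * (1 - (u \<bullet> y)\<^sup>2) / (1 + u \<bullet> y)"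
    using k1 by (simp add: 2 sum_divide_distrib[symmetric] sum_distrib_left[symmetric] divide_right_mono)
  also have "\<dots> = 2 * (1 - u \<bullet> y)"
    using k1 by (simp add: power2_eq_square field_simps)
  finally have "(norm (Y - U))\<^sup>2 \<le> 4 * (1 - u \<bullet> y)"
    unfolding norm_matrix_sq_eq_sum_columns sum.remove[OF finite UNIV_I, of _ j] 1 by simp
  then show thesis using that YY colj by (simp add: u_def)
qed

definition neg_vec :: "real ^ 'n \<Rightarrow> real ^ 'n" where
  "neg_vec x = (\<chi> i. max (- (x $ i)) 0)"

text \<open>The map \<open>neg_vec\<close> is nonexpansive, because \<open>t \<mapsto> max (- t) 0\<close> is.\<close>
lemma norm_neg_vec_le: "norm (neg_vec u) \<le> norm (neg_vec x) + norm (x - u)"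
proof -
  have "norm (neg_vec u) - norm (neg_vec x) \<le> norm (neg_vec u - neg_vec x)"
    by (rule norm_triangle_ineq2)
  also have "\<dots> \<le> norm (x - u)"
    by (rule norm_le_componentwise_cart) (auto simp: neg_vec_def)
  finally show ?thesis by simp
qed

text \<open>
  Split \<open>u = column j U\<close> into its positive part \<open>p\<close> and its negative part, which are orthogonal, and
  rotate \<open>u\<close> to \<open>y = p /\<^sub>R norm p\<close>. Then \<open>u \<bullet> y = norm p\<close>, and since \<open>norm p \<le> 1\<close>,
  \<open>1 - norm p \<le> 1 - (norm p)\<^sup>2 = (norm (neg_vec u))\<^sup>2\<close>. If \<open>p = 0\<close> there is nothing to normalise, but
  then \<open>- u\<close> is nonnegative and changing the sign of that single column costs \<open>2\<close>, which is twice the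
  norm of the negative part.
\<close>
lemma nonneg_column_stiefel:
  fixes U :: "real ^ 'r ^ 'n"
  assumes U: "transpose U ** U = mat 1"
  obtains Y :: "real ^ 'r ^ 'n" where "transpose Y ** Y = mat 1" and "\<And>i. 0 \<le> column j Y $ i"
    and "norm (Y - U) \<le> 2 * norm (neg_vec (column j U))"
proof -
  define u where "u = column j U"
  define p where "p = u + neg_vec u"
  have on: "column i U \<bullet> column i' U = (if i = i' then 1 else 0)" for i i'
    using U by (simp add: orthonormal_columns_iff)
  have p0: "0 \<le> p $ i" for i by (simp add: p_def neg_vec_def)
  have pn: "p \<bullet> neg_vec u = 0"
    unfolding inner_vec_def by (intro sum.neutral) (auto simp: p_def neg_vec_def max_def)
  have u: "u = p - neg_vec u" by (simp add: p_def)
  have "u \<bullet> u = p \<bullet> p + neg_vec u \<bullet> neg_vec u"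
    using pn by (subst (1 2) u) (simp add: inner_diff inner_commute)
  then have pyth: "(norm p)\<^sup>2 + (norm (neg_vec u))\<^sup>2 = 1"
    by (simp add: u_def on power2_norm_eq_inner)
  show thesis
  proof (cases "p = 0")
    case True
    define Y where "Y = (\<chi> i k. if k = j then - U $ i $ k else U $ i $ k)"
    have neg: "neg_vec u = - u"
      using True by (simp add: p_def eq_neg_iff_add_eq_0 add.commute)
    have col: "column k Y = (if k = j then - column k U else column k U)" for k
      by (simp add: Y_def column_def vec_eq_iff)
    have "transpose Y ** Y = mat 1"
      by (simp add: orthonormal_columns_iff col on)
    moreover have "0 \<le> column j Y $ i" for i
    proof -
      have "column j Y = neg_vec u" by (simp add: col neg u_def[symmetric])
      then show ?thesis by (simp add: neg_vec_def)
    qed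
    moreover have "norm (Y - U) \<le> 2 * norm (neg_vec (column j U))"
    proof -
      have "(norm (Y - U))\<^sup>2 = (norm (- u - u))\<^sup>2"
        unfolding norm_matrix_sq_eq_sum_columns column_diff col
        by (subst sum.remove[of _ j]) (simp_all add: u_def)
      then have "norm (Y - U) = norm (- u - u)" by simp
      also have "- u - u = 2 *\<^sub>R neg_vec u" by (simp add: neg scaleR_2)
      finally show ?thesis by (simp add: u_def)
    qed
    ultimately show thesis by (rule that)
  next
    case False
    define y where "y = p /\<^sub>R norm p"
    have y: "y \<bullet> y = 1"
      using False by (simp add: y_def power2_norm_eq_inner[symmetric] power2_eq_square field_simps)
    have "u \<bullet> p = (norm p)\<^sup>2"
      using pn by (subst u) (simp add: inner_diff inner_commute power2_norm_eq_inner)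
    then have k: "u \<bullet> y = norm p" using False by (simp add: y_def power2_eq_square)
    obtain Y :: "real ^ 'r ^ 'n" where Y: "transpose Y ** Y = mat 1" "column j Y = y"
      and d: "(norm (Y - U))\<^sup>2 \<le> 4 * (1 - column j U \<bullet> y)"
    proof (rule rotate_column[OF U y])
      show "- 1 < column j U \<bullet> y"
        using k norm_ge_zero[of p] unfolding u_def[symmetric] by linarith
    qed
    have "(norm p)\<^sup>2 \<le> 1\<^sup>2"
      using pyth zero_le_power2[of "norm (neg_vec u)"] unfolding one_power2 by linarith
    then have "norm p \<le> 1" by (rule power2_le_imp_le) simp
    then have "(norm p)\<^sup>2 \<le> norm p" by (simp add: power2_eq_square mult_left_le)
    then have "(norm (Y - U))\<^sup>2 \<le> 4 * (norm (neg_vec u))\<^sup>2"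
      using d k pyth by (simp add: u_def[symmetric])
    then have "(norm (Y - U))\<^sup>2 \<le> (2 * norm (neg_vec u))\<^sup>2"
      by (simp add: power_mult_distrib)
    then have "norm (Y - U) \<le> 2 * norm (neg_vec u)"
      by (rule power2_le_imp_le) simp
    moreover have "0 \<le> column j Y $ i" for i
      using p0 by (simp add: Y(2) y_def)
    ultimately show thesis using that Y(1) by (simp add: u_def)
  qed
qed

text \<open>
  The coefficient \<open>3\<close> is \<open>1\<close> for the move to the polar factor plus \<open>2\<close> for the damage which that move
  may do to the sign of column \<open>j\<close>.
\<close>
lemma dist_nonneg_column_stiefel:
  fixes X :: "real ^ 'r ^ 'n"
  assumes "CARD('r) \<le> CARD('n)"
  obtains Y :: "real ^ 'r ^ 'n" where "transpose Y ** Y = mat 1" and "\<And>i. 0 \<le> Y $ i $ j"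
    and "dist X Y \<le> 2 * norm (neg_vec (column j X)) + 3 * norm (transpose X ** X - mat 1)"
proof -
  obtain U :: "real ^ 'r ^ 'n" where U: "transpose U ** U = mat 1"
    and XU: "norm (X - U) \<le> norm (transpose X ** X - mat 1)"
    using dist_stiefel_le[OF assms] by blast
  obtain Y :: "real ^ 'r ^ 'n" where Y: "transpose Y ** Y = mat 1" "\<And>i. 0 \<le> column j Y $ i"
    and YU: "norm (Y - U) \<le> 2 * norm (neg_vec (column j U))"
    using nonneg_column_stiefel[OF U, of j] by blast
  have "norm (neg_vec (column j U)) \<le> norm (neg_vec (column j X)) + norm (column j (X - U))"
    unfolding column_diff by (rule norm_neg_vec_le)
  also have "\<dots> \<le> norm (neg_vec (column j X)) + norm (X - U)"
    by (simp add: norm_column_le_norm_matrix)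
  finally have "norm (neg_vec (column j U)) \<le> norm (neg_vec (column j X)) + norm (X - U)" .
  moreover have "dist X Y \<le> norm (X - U) + norm (Y - U)"
    by (metis dist_norm dist_triangle2)
  ultimately have "dist X Y \<le> 2 * norm (neg_vec (column j X)) + 3 * norm (transpose X ** X - mat 1)"
    using XU YU by linarith
  with Y that show thesis by (simp add: column_def)
qed

section \<open>The distance to the sign-constrained Stiefel manifold\<close>
lemma norm_neg_part_single_column:
  fixes A :: "real ^ 'r ^ 'n"
  assumes "\<And>k. k \<noteq> j \<Longrightarrow> column k A = 0"
  shows "norm (neg_part A) = norm (neg_vec (column j A))"
proof -
  have col: "column k (neg_part A) = neg_vec (column k A)" for k
    by (simp add: neg_part_def neg_vec_def column_def vec_eq_iff)
  have "neg_vec 0 = (0 :: real ^ 'n)" by (simp add: neg_vec_def vec_eq_iff)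
  then have "(norm (neg_part A))\<^sup>2 = (norm (neg_vec (column j A)))\<^sup>2"
    unfolding norm_matrix_sq_eq_sum_columns col
    by (subst sum.remove[of _ j]) (simp_all add: assms)
  then show ?thesis by simp
qed

text \<open>
  Since \<open>card P + card N = 1\<close>, the sign matrix is \<open>s = \<plusminus>1\<close> in one column and zero elsewhere, and
  scaling by \<open>s\<close>, an isometry that preserves Gram matrices, turns the constraint into nonnegativity of
  that column.
\<close>
lemma infdist_sign_stiefel_le:
  fixes P N :: "'r::finite set" and S X :: "real ^ 'r ^ 'n::finite"
  assumes n: "CARD('r) \<le> CARD('n)" and PN: "card P + card N = 1" and S: "S = sign_matrix P N"
  shows "infdist X (sign_stiefel S)
    \<le> 2 * norm (neg_part (S \<circ>\<^sub>H X)) + 3 * norm (transpose X ** X - mat 1)"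
proof -
  obtain j and s :: real where s: "s = 1 \<or> s = - 1"
    and S_eq: "\<And>i k. S $ i $ k = (if k = j then s else 0)"
  proof -
    have "card P = 1 \<and> N = {} \<or> P = {} \<and> card N = 1"
      using PN by (auto simp: add_is_1)
    then consider j where "P = {j}" "N = {}" | j where "P = {}" "N = {j}"
      by (auto simp: card_1_singleton_iff)
    then show thesis
    proof cases
      case 1
      then show ?thesis by (intro that[of 1 j]) (simp_all add: S sign_matrix_def)
    next
      case 2
      then show ?thesis by (intro that[of "- 1" j]) (simp_all add: S sign_matrix_def)
    qed
  qed
  obtain Y :: "real ^ 'r ^ 'n" where Y: "transpose Y ** Y = mat 1" "\<And>i. 0 \<le> Y $ i $ j"
    and d: "dist (s *\<^sub>R X) Y \<le> 2 * norm (neg_vec (column j (s *\<^sub>R X)))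
      + 3 * norm (transpose (s *\<^sub>R X) ** (s *\<^sub>R X) - mat 1)"
    using dist_nonneg_column_stiefel[OF n, of j "s *\<^sub>R X"] by blast
  have ss: "s * s = 1" using s by auto
  have gram: "transpose (s *\<^sub>R A) ** (s *\<^sub>R A) = transpose A ** A" for A :: "real ^ 'r ^ 'n"
    using s by (auto simp: transpose_def matrix_matrix_mult_def vec_eq_iff)
  have "s *\<^sub>R Y \<in> sign_stiefel S"
    unfolding sign_stiefel_def
    by (simp add: gram Y hadamard_def S_eq mult.assoc[symmetric] ss)
  then have "infdist X (sign_stiefel S) \<le> dist X (s *\<^sub>R Y)" by (rule infdist_le)
  also have "\<dots> = norm (s *\<^sub>R (X - s *\<^sub>R Y))"
    using s by (auto simp: dist_norm)
  also have "\<dots> = dist (s *\<^sub>R X) Y"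
    by (simp add: dist_norm scaleR_diff_right ss)
  also note d
  also have "norm (neg_vec (column j (s *\<^sub>R X))) = norm (neg_part (S \<circ>\<^sub>H X))"
  proof (subst norm_neg_part_single_column)
    show "column k (S \<circ>\<^sub>H X) = 0" if "k \<noteq> j" for k
      using that by (simp add: column_def hadamard_def S_eq vec_eq_iff)
    have "column j (s *\<^sub>R X) = column j (S \<circ>\<^sub>H X)"
      by (simp add: column_def hadamard_def S_eq vec_eq_iff)
    then show "norm (neg_vec (column j (s *\<^sub>R X))) = norm (neg_vec (column j (S \<circ>\<^sub>H X)))" by simp
  qed
  finally show ?thesis by (simp add: gram)
qed

theorem theorem7:
  fixes P N :: "'r::finite set"
    and S X :: "real ^ 'r ^ 'n::finite"
  assumes "CARD('r) \<le> CARD('n)"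
    and "P \<inter> N = {}"
    and "card P + card N = 1"
    and "S = sign_matrix P N"
  shows "infdist X (sign_stiefel S)
           \<le> 7 * sqrt (real CARD('r)) *
               (norm (neg_part (S \<circ>\<^sub>H X)) + norm (transpose X ** X - mat 1))
         \<and> (norm (transpose X ** X - mat 1) < 1 / 3 \<longrightarrow>
             infdist X (sign_stiefel S)
               \<le> 7 * (norm (neg_part (S \<circ>\<^sub>H X)) + norm (transpose X ** X - mat 1)))"
proof -
  define a where "a = norm (neg_part (S \<circ>\<^sub>H X))"
  define b where "b = norm (transpose X ** X - mat 1)"
  have ab: "0 \<le> a" "0 \<le> b" by (simp_all add: a_def b_def)
  have "infdist X (sign_stiefel S) \<le> 2 * a + 3 * b"
    unfolding a_def b_def by (rule infdist_sign_stiefel_le[OF assms(1,3,4)])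
  also have "\<dots> \<le> 7 * (a + b)" using ab by simp
  finally have le: "infdist X (sign_stiefel S) \<le> 7 * (a + b)" .
  also have "\<dots> \<le> 7 * sqrt (real CARD('r)) * (a + b)"
    using ab by (intro mult_right_mono) (simp_all add: Suc_le_eq)
  finally show ?thesis using le unfolding a_def b_def by blast
qed

end
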